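(* For each real number $q\ge 1$ and each integer $n\ge 1$, the map $N_q:M_n(\mathbb{C})\to\mathbb{R}_+$ given by $$N_q(A)=\Bigg(\int_{\mathbb{S}^n}\big\lVert |A|^{1/2}\xi\big\rVert_2^{2q}\,d\sigma(\xi)\Bigg)^{1/q}$$ defines a unitarily invariant norm on $M_n(\mathbb{C})$.
   Context: $\mathbb{S}^n$ denotes the unit sphere of $\mathbb{C}^n$ and $\sigma$ the normalized Euclidean surface measure on it (so $\sigma(\mathbb{S}^n)=1$). $\lVert\cdot\rVert_2$ is the Euclidean norm on $\mathbb{C}^n$. For $A\in M_n(\mathbb{C})$, $A^\star$ is the conjugate transpose and $|A|=\sqrt{A^\star A}$. A norm $\tau$ on $M_n(\mathbb{C})$ is unitarily invariant if $\tau(A)=\tau(UAV)$ for all $A\in M_n(\mathbb{C})$ and all unitary $U,V\in M_n(\mathbb{C})$. *)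

theory Defs
  imports "HOL-Analysis.Analysis"
begin

text \<open>
  Polar-coordinate definition of the (Borel) Euclidean surface measure on the unit sphere of a
  Euclidean space of real dimension \<open>d\<close>: the measure of \<open>E\<close> is \<open>d\<close> times the Lebesgue measure of
  the punctured cone over \<open>E\<close>, as stated in the next lemma. Here \<open>sgn x = x /\<^sub>R norm x\<close> is the
  radial projection. On \<open>complex ^ 'n\<close> the real dimension is \<open>2 * CARD('n)\<close>, and \<open>norm\<close> is the
  Euclidean norm.
\<close>

definition surface_measure :: "'a::euclidean_space measure" where
  "surface_measure =
     scale_measure (of_nat DIM('a))
       (distr (restrict_space lborel (cball 0 1 - {0})) (restrict_space borel (sphere 0 1)) sgn)"

definition sphere_measure :: "'a::euclidean_space measure" where
  "sphere_measure = uniform_measure surface_measure (sphere 0 1)"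

lemma emeasure_surface_measure:
  fixes E :: "'a::euclidean_space set"
  assumes "E \<in> sets borel" "E \<subseteq> sphere 0 1"
  shows "emeasure surface_measure E =
    of_nat DIM('a) * emeasure lborel {t *\<^sub>R x | t x. 0 < t \<and> t \<le> 1 \<and> x \<in> E}"
proof -
  have m: "(sgn :: 'a \<Rightarrow> 'a) \<in> restrict_space lborel (cball 0 1 - {0})
      \<rightarrow>\<^sub>M restrict_space borel (sphere 0 1)"
    by (rule measurable_restrict_space2)
      (auto simp: space_restrict_space norm_sgn intro!: measurable_restrict_space1)
  have E: "E \<in> sets (restrict_space borel (sphere 0 1))"
    using assms by (auto simp: sets_restrict_space)
  have eq: "sgn -` E \<inter> (cball 0 1 - {0}) = {t *\<^sub>R x | t x. 0 < t \<and> t \<le> 1 \<and> x \<in> E}" (is "?L = ?R")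
  proof
    show "?L \<subseteq> ?R"
    proof
      fix y assume y: "y \<in> ?L"
      then have "y = norm y *\<^sub>R sgn y" "0 < norm y" "norm y \<le> 1" "sgn y \<in> E"
        by (auto simp: sgn_div_norm)
      then show "y \<in> ?R" by blast
    qed
    show "?R \<subseteq> ?L"
      using assms(2) by (auto simp: sgn_div_norm)
  qed
  have sub: "{t *\<^sub>R x | t x. 0 < t \<and> t \<le> 1 \<and> x \<in> E} \<subseteq> cball 0 1 - {0}"
    using eq by blast
  have "emeasure (restrict_space lborel (cball 0 1 - {0})) (sgn -` E \<inter> (cball 0 1 - {0})) =
      emeasure lborel {t *\<^sub>R x | t x. 0 < t \<and> t \<le> 1 \<and> x \<in> E}"
    unfolding eq by (rule emeasure_restrict_space) (use sub in auto)
  then show ?thesis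
    by (simp add: surface_measure_def emeasure_distr[OF m E] space_restrict_space)
qed

lemma emeasure_sphere_measure_sphere:
  "emeasure sphere_measure (sphere 0 1 :: 'a::euclidean_space set) = 1"
proof -
  let ?S = "sphere 0 1 :: 'a set"
  let ?C = "{t *\<^sub>R x | t x. 0 < t \<and> t \<le> 1 \<and> x \<in> ?S}"
  have C: "?C = cball 0 1 - {0}"
  proof
    show "?C \<subseteq> cball 0 1 - {0}" by auto
    show "cball 0 1 - {0} \<subseteq> ?C"
    proof
      fix y :: 'a assume y: "y \<in> cball 0 1 - {0}"
      then have "y = norm y *\<^sub>R sgn y" "0 < norm y" "norm y \<le> 1" "sgn y \<in> ?S"
        by (auto simp: sgn_div_norm)
      then show "y \<in> ?C" by blast
    qed
  qed
  have "emeasure lborel (cball 0 1 - {0 :: 'a}) = emeasure lborel (cball (0::'a) 1)"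
    by (rule emeasure_Diff_null_set) auto
  then have c: "emeasure lborel ?C = emeasure lborel (cball (0::'a) 1)"
    by (simp only: C)
  have fin: "emeasure lborel (cball (0::'a) 1) < \<infinity>"
    by (rule emeasure_lborel_cball_finite)
  have pos: "emeasure lborel (cball (0::'a) 1) \<noteq> 0"
    using content_cball_pos[of 1 "0::'a"] by (auto simp: measure_def)
  have s: "emeasure surface_measure ?S = of_nat DIM('a) * emeasure lborel (cball (0::'a) 1)"
    using emeasure_surface_measure[of ?S] c by simp
  have "emeasure surface_measure ?S \<noteq> 0" "emeasure surface_measure ?S \<noteq> \<infinity>"
    using s pos fin by (auto simp: ennreal_mult_eq_top_iff)
  moreover have "?S \<in> sets surface_measure"
    by (auto simp: surface_measure_def sets_restrict_space image_iff intro!: bexI[of _ ?S])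
  ultimately show ?thesis
    by (simp add: sphere_measure_def ennreal_divide_self less_top)
qed

definition adjoint_matrix :: "complex ^ 'n ^ 'm \<Rightarrow> complex ^ 'm ^ 'n" where
  "adjoint_matrix A = map_matrix cnj (transpose A)"

definition unitary_matrix :: "complex ^ 'n ^ 'n \<Rightarrow> bool" where
  "unitary_matrix U \<longleftrightarrow> adjoint_matrix U ** U = mat 1 \<and> U ** adjoint_matrix U = mat 1"

definition psd_matrix :: "complex ^ 'n ^ 'n \<Rightarrow> bool" where
  "psd_matrix A \<longleftrightarrow> adjoint_matrix A = A \<and>
     (\<forall>x. 0 \<le> Re (\<Sum>i\<in>UNIV. cnj (x $ i) * (A *v x) $ i))"

text \<open>The positive semidefinite square root; only meaningful for positive semidefinite \<open>A\<close>.\<close>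

definition sqrt_matrix :: "complex ^ 'n ^ 'n \<Rightarrow> complex ^ 'n ^ 'n" where
  "sqrt_matrix A = (THE B. psd_matrix B \<and> B ** B = A)"

definition abs_matrix :: "complex ^ 'n ^ 'n \<Rightarrow> complex ^ 'n ^ 'n" where
  "abs_matrix A = sqrt_matrix (adjoint_matrix A ** A)"

text \<open>
  Norms on the complex vector space of matrices: homogeneity is over complex scalars, with
  \<open>map_matrix ((*) c) A\<close> the scalar multiple of \<open>A\<close> by \<open>c\<close>.
\<close>

definition norm_on_matrices :: "(complex ^ 'n ^ 'n \<Rightarrow> real) \<Rightarrow> bool" where
  "norm_on_matrices \<tau> \<longleftrightarrow>
     (\<forall>A. 0 \<le> \<tau> A) \<and>
     (\<forall>A. \<tau> A = 0 \<longleftrightarrow> A = 0) \<and>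
     (\<forall>c A. \<tau> (map_matrix ((*) c) A) = cmod c * \<tau> A) \<and>
     (\<forall>A B. \<tau> (A + B) \<le> \<tau> A + \<tau> B)"

definition unitarily_invariant_norm :: "(complex ^ 'n ^ 'n \<Rightarrow> real) \<Rightarrow> bool" where
  "unitarily_invariant_norm \<tau> \<longleftrightarrow> norm_on_matrices \<tau> \<and>
     (\<forall>A U V. unitary_matrix U \<longrightarrow> unitary_matrix V \<longrightarrow> \<tau> A = \<tau> (U ** A ** V))"

definition norm_N :: "real \<Rightarrow> complex ^ 'n ^ 'n \<Rightarrow> real" where
  "norm_N q A =
     (LINT \<xi>|sphere_measure. norm (sqrt_matrix (abs_matrix A) *v \<xi>) powr (2 * q)) powr (1 / q)"

end

theory Submission
  imports Defs
begin

text \<open>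
  Since \<open>\<parallel>|A|\<^sup>1\<^sup>/\<^sup>2 x\<parallel>\<^sup>2 = x \<bullet> |A| x\<close>, the value \<open>N A\<close> is the \<open>L\<^sup>q\<close> norm of the form \<open>x \<bullet> |A| x\<close>
  on the sphere. For the triangle inequality choose a unitary \<open>W\<close> with \<open>|A + B| = W (A + B)\<close>. By
  Minkowski, \<open>N (A + B)\<close> is at most the sum of the \<open>L\<^sup>q\<close> norms of \<open>x \<bullet> W A x\<close> and \<open>x \<bullet> W B x\<close>. For
  every matrix \<open>X\<close> the \<open>L\<^sup>q\<close> norm of \<open>x \<bullet> X x\<close> is at most \<open>N X\<close>: with the polar decomposition
  \<open>X = V |X|\<close>, Cauchy-Schwarz for the form of \<open>|X|\<close> bounds it by the forms of \<open>|X|\<close> at \<open>x\<close> and at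
  \<open>V\<^sup>* x\<close>, which have the same integrals. Finally \<open>N (W A) = N A\<close> and \<open>N (W B) = N B\<close>.
\<close>

section \<open>Rotation invariance of the sphere measure\<close>

lemma nn_integral_lborel_translation:
  fixes h :: "'a::euclidean_space \<Rightarrow> ennreal"
  assumes [measurable]: "h \<in> borel_measurable borel"
  shows "(\<integral>\<^sup>+x. h (x + a) \<partial>lborel) = (\<integral>\<^sup>+x. h x \<partial>lborel)"
proof -
  have "(\<integral>\<^sup>+x. h x \<partial>lborel) = (\<integral>\<^sup>+x. h x \<partial>distr lborel borel (\<lambda>x. a + x))"
    by (simp add: lborel_distr_plus)
  also have "\<dots> = (\<integral>\<^sup>+x. h (x + a) \<partial>lborel)"
    by (subst nn_integral_distr) (auto simp: add.commute)
  finally show ?thesis ..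
qed

lemma nn_integral_lborel_reflection:
  fixes h :: "'a::euclidean_space \<Rightarrow> ennreal"
  assumes [measurable]: "h \<in> borel_measurable borel"
  shows "(\<integral>\<^sup>+x. h (a - x) \<partial>lborel) = (\<integral>\<^sup>+x. h x \<partial>lborel)"
proof -
  have "lborel = distr lborel borel (\<lambda>x::'a. a - x)"
    using lborel_affine[of "-1" a] by (simp add: density_1)
  then have "(\<integral>\<^sup>+x. h x \<partial>lborel) = (\<integral>\<^sup>+x. h x \<partial>distr lborel borel (\<lambda>x. a - x))"
    by simp
  also have "\<dots> = (\<integral>\<^sup>+x. h (a - x) \<partial>lborel)"
    by (subst nn_integral_distr) auto
  finally show ?thesis ..
qed

text \<open>
  Uniqueness of Haar measure, specialised: for \<open>h\<close> the indicator of the (rotation invariant) unit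
  ball, integrate \<open>g (f x) * h (f x + y)\<close> in both orders and translate.
\<close>

lemma nn_integral_lborel_orthogonal:
  fixes f :: "'a::euclidean_space \<Rightarrow> 'a" and g :: "'a \<Rightarrow> ennreal"
  assumes f: "orthogonal_transformation f" and [measurable]: "g \<in> borel_measurable borel"
  shows "(\<integral>\<^sup>+x. g (f x) \<partial>lborel) = (\<integral>\<^sup>+x. g x \<partial>lborel)"
proof -
  define h where "h = (indicator (cball 0 1) :: 'a \<Rightarrow> ennreal)"
  have [measurable]: "h \<in> borel_measurable borel"
    unfolding h_def by (intro borel_measurable_indicator) simp
  have lin: "linear f" using f by (rule orthogonal_transformation_linear)
  then have [measurable]: "f \<in> borel_measurable borel"
    by (intro borel_measurable_continuous_onI linear_continuous_on) (simp add: linear_linear)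
  have [measurable]: "g \<in> borel_measurable lborel" by simp
  have hf: "h (f x) = h x" for x
    using f by (auto simp: h_def indicator_def orthogonal_transformation_norm)
  \<comment> \<open>A right inverse of \<open>f\<close>: translating \<open>x\<close> by
    \<open>k y\<close> translates \<open>f x\<close> by \<open>y\<close>.\<close>
  obtain k where k: "\<And>y. f (k y) = y"
    using orthogonal_transformation_surj[OF f] by (metis surjD)
  define H where "H = (\<integral>\<^sup>+x. h x \<partial>lborel)"
  have Heq: "H = emeasure lborel (cball (0::'a) 1)"
    by (simp add: H_def h_def)
  \<comment> \<open>The ball has positive finite volume, so the factor \<open>H\<close> on both
    sides can be cancelled at the end by division in \<open>ennreal\<close>.\<close>
  have H: "H \<noteq> 0" "H \<noteq> top"
    using content_cball_pos[of 1 "0::'a"] emeasure_lborel_cball_finite[of "0::'a" 1]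
    by (auto simp: Heq measure_def)
  have "(\<integral>\<^sup>+x. g (f x) \<partial>lborel) * H = (\<integral>\<^sup>+x. (\<integral>\<^sup>+y. g (f x) * h (y + f x) \<partial>lborel) \<partial>lborel)"
    by (simp add: nn_integral_cmult nn_integral_lborel_translation nn_integral_multc H_def)
  also have "\<dots> = (\<integral>\<^sup>+y. (\<integral>\<^sup>+x. g (f x) * h (y + f x) \<partial>lborel) \<partial>lborel)"
    by (intro lborel_pair.Fubini') measurable
  \<comment> \<open>Translation by \<open>k y\<close> moves \<open>y\<close> from the argument of
    \<open>h\<close> to that of \<open>g\<close>. Since \<open>h (f x) = h x\<close>, integrating
    over \<open>y\<close> first then removes \<open>f\<close> altogether.\<close>
  also have "\<dots> = (\<integral>\<^sup>+y. (\<integral>\<^sup>+x. g (f x - y) * h (f x) \<partial>lborel) \<partial>lborel)"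
  proof (rule nn_integral_cong)
    fix y
    have "(\<integral>\<^sup>+x. g (f x - y) * h (f x) \<partial>lborel) = (\<integral>\<^sup>+x. g (f (x + k y) - y) * h (f (x + k y)) \<partial>lborel)"
      by (rule nn_integral_lborel_translation[symmetric]) measurable
    then show "(\<integral>\<^sup>+x. g (f x) * h (y + f x) \<partial>lborel) = (\<integral>\<^sup>+x. g (f x - y) * h (f x) \<partial>lborel)"
      by (simp add: linear_add[OF lin] k add.commute)
  qed
  also have "\<dots> = (\<integral>\<^sup>+x. (\<integral>\<^sup>+y. g (f x - y) * h (f x) \<partial>lborel) \<partial>lborel)"
    by (intro lborel_pair.Fubini') measurable
  also have "\<dots> = (\<integral>\<^sup>+x. g x \<partial>lborel) * H"
    by (simp add: nn_integral_multc nn_integral_lborel_reflection nn_integral_cmult hf H_def)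
  finally have "(\<integral>\<^sup>+x. g (f x) \<partial>lborel) * H / H = (\<integral>\<^sup>+x. g x \<partial>lborel) * H / H"
    by simp
  then show ?thesis
    unfolding ennreal_mult_divide_eq[OF H] .
qed

lemma emeasure_lborel_orthogonal_vimage:
  fixes f :: "'a::euclidean_space \<Rightarrow> 'a"
  assumes f: "orthogonal_transformation f" and [measurable]: "A \<in> sets borel"
  shows "emeasure lborel (f -` A) = emeasure lborel A"
proof -
  have [measurable]: "f \<in> borel_measurable borel"
    using orthogonal_transformation_linear[OF f]
    by (intro borel_measurable_continuous_onI linear_continuous_on) (simp add: linear_linear)
  have [measurable]: "f -` A \<in> sets borel"
    using measurable_sets[of f borel borel A] by simp
  have "emeasure lborel (f -` A) = (\<integral>\<^sup>+x. indicator (f -` A) x \<partial>lborel)"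
    by (rule nn_integral_indicator[symmetric]) simp
  also have "\<dots> = (\<integral>\<^sup>+x. indicator A (f x) \<partial>lborel)"
    by (intro nn_integral_cong) (simp split: split_indicator)
  also have "\<dots> = emeasure lborel A"
    by (subst nn_integral_lborel_orthogonal[OF f]) auto
  finally show ?thesis .
qed

section \<open>The normalized sphere measure and its rotation invariance\<close>

lemma sets_surface_measure:
  "sets (surface_measure :: 'a::euclidean_space measure) = sets (restrict_space borel (sphere 0 1))"
  by (simp add: surface_measure_def)

lemma sets_sphere_measure [measurable_cong]:
  "sets (sphere_measure :: 'a::euclidean_space measure) = sets (restrict_space borel (sphere 0 1))"
  by (simp add: sphere_measure_def sets_surface_measure)

lemma space_sphere_measure: "space (sphere_measure :: 'a::euclidean_space measure) = sphere 0 1"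
  using sets_eq_imp_space_eq[OF sets_sphere_measure] by (simp add: space_restrict_space)

lemma sets_sphere_measure_iff:
  "E \<in> sets (sphere_measure :: 'a::euclidean_space measure) \<longleftrightarrow> E \<in> sets borel \<and> E \<subseteq> sphere 0 1"
  unfolding sets_sphere_measure by (subst sets_restrict_space_iff) auto

lemma emeasure_sphere_measure:
  fixes E :: "'a::euclidean_space set"
  assumes "E \<in> sets borel" "E \<subseteq> sphere 0 1"
  shows "emeasure sphere_measure E =
    emeasure surface_measure E / emeasure surface_measure (sphere (0::'a) 1)"
proof -
  have "sphere (0::'a) 1 \<inter> E = E" using assms by auto
  moreover have "E \<in> sets surface_measure" "sphere (0::'a) 1 \<in> sets surface_measure"
    using assms by (simp_all add: sets_surface_measure sets_restrict_space_iff)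
  ultimately show ?thesis
    by (simp add: sphere_measure_def)
qed

interpretation sphere_measure: finite_measure "sphere_measure :: 'a::euclidean_space measure"
  by (rule finite_measureI) (simp add: space_sphere_measure emeasure_sphere_measure_sphere)

text \<open>Puts the cone of \<open>emeasure_surface_measure\<close> in a form where Borel
  measurability is immediate and where an orthogonal map, which commutes with \<open>sgn\<close>,
  acts by preimages.\<close>

lemma cone_eq_vimage_sgn:
  fixes E :: "'a::euclidean_space set"
  assumes "E \<subseteq> sphere 0 1"
  shows "{t *\<^sub>R x | t x. 0 < t \<and> t \<le> 1 \<and> x \<in> E} = sgn -` E \<inter> (cball 0 1 - {0})"
proof safe
  fix x assume "sgn x \<in> E" "x \<in> cball 0 1" "x \<notin> {}" "x \<noteq> 0"
  then show "\<exists>t y. x = t *\<^sub>R y \<and> 0 < t \<and> t \<le> 1 \<and> y \<in> E"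
    by (intro exI[of _ "norm x"] exI[of _ "sgn x"]) (auto simp: sgn_div_norm)
qed (use assms in \<open>auto simp: sgn_div_norm\<close>)

lemma sets_borel_vimage_sgn [measurable]:
  fixes E :: "'a::euclidean_space set"
  assumes "E \<in> sets borel"
  shows "sgn -` E \<inter> (cball 0 1 - {0}) \<in> sets borel"
proof -
  have "sgn -` E \<inter> space borel \<in> sets borel"
    by (rule measurable_sets[OF _ assms]) simp
  then show ?thesis by auto
qed

lemma orthogonal_transformation_measurable_sphere:
  fixes f :: "'a::euclidean_space \<Rightarrow> 'a"
  assumes f: "orthogonal_transformation f"
  shows "f \<in> sphere_measure \<rightarrow>\<^sub>M sphere_measure"
proof -
  have "f \<in> borel_measurable borel"
    using orthogonal_transformation_linear[OF f]
    by (intro borel_measurable_continuous_onI linear_continuous_on) (simp add: linear_linear)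
  then have "f \<in> restrict_space borel (sphere 0 1) \<rightarrow>\<^sub>M restrict_space borel (sphere 0 1)"
    using f by (intro measurable_restrict_space3) (auto simp: orthogonal_transformation_norm)
  then show ?thesis
    using measurable_cong_sets[OF sets_sphere_measure sets_sphere_measure] by blast
qed

text \<open>An orthogonal map preserves norms and commutes with \<open>sgn\<close>, so the cone over
  the preimage of \<open>E\<close> is the preimage of the cone over \<open>E\<close>. The two cones
  have equal Lebesgue measure.\<close>

lemma distr_sphere_measure_orthogonal:
  fixes f :: "'a::euclidean_space \<Rightarrow> 'a"
  assumes f: "orthogonal_transformation f"
  shows "distr sphere_measure sphere_measure f = sphere_measure"
proof (rule measure_eqI)
  fix E assume "E \<in> sets (distr sphere_measure sphere_measure f)"
  then have E: "E \<in> sets borel" "E \<subseteq> sphere 0 1"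
    by (auto simp: sets_sphere_measure_iff)
  have m [measurable]: "f \<in> sphere_measure \<rightarrow>\<^sub>M sphere_measure"
    using f by (rule orthogonal_transformation_measurable_sphere)
  define F where "F = f -` E \<inter> sphere 0 1"
  have "f -` E \<inter> space sphere_measure \<in> sets sphere_measure"
    by (rule measurable_sets[OF m]) (use E sets_sphere_measure_iff in auto)
  then have F: "F \<in> sets borel" "F \<subseteq> sphere 0 1"
    by (auto simp: sets_sphere_measure_iff F_def space_sphere_measure)
  have lin: "linear f" using f by (rule orthogonal_transformation_linear)
  have n: "norm (f x) = norm x" for x
    using f by (rule orthogonal_transformation_norm)
  have s: "sgn (f x) = f (sgn x)" for x
    by (simp add: sgn_div_norm n linear_scale[OF lin])
  have nz: "f x = 0 \<longleftrightarrow> x = 0" for x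
    using n[of x] by auto
  have "sgn -` F \<inter> (cball 0 1 - {0}) = f -` (sgn -` E \<inter> (cball 0 1 - {0}))"
    using F E by (auto simp: F_def s n nz norm_sgn)
  then have "emeasure surface_measure F = emeasure surface_measure E"
    using E F by (simp add: emeasure_surface_measure cone_eq_vimage_sgn
        emeasure_lborel_orthogonal_vimage[OF f] del: vimage_Int)
  moreover have "emeasure (distr sphere_measure sphere_measure f) E = emeasure sphere_measure F"
    using E sets_sphere_measure_iff
    by (subst emeasure_distr) (auto simp: F_def space_sphere_measure)
  ultimately show "emeasure (distr sphere_measure sphere_measure f) E = emeasure sphere_measure E"
    using E F by (simp add: emeasure_sphere_measure)
qed simp

lemma integral_sphere_measure_orthogonal:
  fixes f :: "'a::euclidean_space \<Rightarrow> 'a" and h :: "'a \<Rightarrow> real"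
  assumes f: "orthogonal_transformation f" and h: "h \<in> borel_measurable sphere_measure"
  shows "(LINT x|sphere_measure. h (f x)) = (LINT x|sphere_measure. h x)"
  using integral_distr[OF orthogonal_transformation_measurable_sphere[OF f] h]
  by (simp add: distr_sphere_measure_orthogonal[OF f])

section \<open>Integrals of continuous functions and null sets on the sphere\<close>

lemma borel_measurable_sphere_measure:
  fixes h :: "'a::euclidean_space \<Rightarrow> real"
  assumes "continuous_on UNIV h"
  shows "h \<in> borel_measurable sphere_measure"
proof -
  have "h \<in> borel_measurable (restrict_space borel (sphere 0 1))"
    using assms by (intro measurable_restrict_space1 borel_measurable_continuous_onI)
  then show ?thesis
    using measurable_cong_sets[OF sets_sphere_measure refl] by blast
qed

lemma integrable_sphere_measure:
  fixes h :: "'a::euclidean_space \<Rightarrow> real"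
  assumes "continuous_on UNIV h"
  shows "integrable sphere_measure h"
proof -
  have "compact (h ` sphere 0 1)"
    using assms by (intro compact_continuous_image) (auto intro: continuous_on_subset)
  then obtain B where "\<And>x. x \<in> sphere 0 1 \<Longrightarrow> \<bar>h x\<bar> \<le> B"
    by (force dest!: compact_imp_bounded simp: bounded_iff)
  then show ?thesis
    using assms
    by (intro sphere_measure.integrable_const_bound[of _ B])
      (auto simp: borel_measurable_sphere_measure space_sphere_measure intro!: AE_I2)
qed

text \<open>Nonvanishing of \<open>f\<close> is invariant under positive scaling, so a null
  exceptional set on the sphere has a null cone. This cone contains the open set of points of the
  ball where \<open>f\<close> is nonzero, which must therefore be empty.\<close>

lemma linear_zero_if_AE_sphere_zero:
  fixes f :: "'a::euclidean_space \<Rightarrow> 'b::real_normed_vector"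
  assumes f: "bounded_linear f" and ae: "AE x in sphere_measure. f x = 0"
  shows "f x = 0"
proof -
  interpret f: bounded_linear f by (rule f)
  have op: "open {x. f x \<noteq> 0}"
    by (intro open_Collect_neq f.continuous_on continuous_intros)
  define E where "E = {x. f x \<noteq> 0} \<inter> sphere 0 1"
  have E: "E \<in> sets borel" "E \<subseteq> sphere 0 1"
    using op by (auto simp: E_def)
  have "emeasure sphere_measure E = 0"
    using ae E sets_sphere_measure_iff[of E]
    by (subst (asm) AE_iff_measurable[of E]) (auto simp: E_def space_sphere_measure)
  moreover have "emeasure surface_measure (sphere (0::'a) 1) \<noteq> \<infinity>"
    using emeasure_sphere_measure_sphere[where 'a='a] emeasure_sphere_measure[of "sphere (0::'a) 1"]
    by (auto simp: ennreal_divide_top)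
  ultimately have "emeasure surface_measure E = 0"
    using E by (simp add: emeasure_sphere_measure)
  then have "emeasure lborel (sgn -` E \<inter> (cball 0 1 - {0})) = 0"
    using E by (simp add: emeasure_surface_measure cone_eq_vimage_sgn)
  then have "negligible (sgn -` E \<inter> (cball 0 1 - {0}))"
    using E by (simp add: negligible_iff_null_sets null_sets_completionI null_setsI)
  moreover have "{x. f x \<noteq> 0} \<inter> ball 0 1 \<subseteq> sgn -` E \<inter> (cball 0 1 - {0})"
  proof
    fix x assume x: "x \<in> {x. f x \<noteq> 0} \<inter> ball 0 1"
    then have "x \<noteq> 0" by (auto simp: f.zero)
    with x show "x \<in> sgn -` E \<inter> (cball 0 1 - {0})"
      by (auto simp: E_def norm_sgn sgn_div_norm f.scaleR)
  qed
  ultimately have "negligible ({x. f x \<noteq> 0} \<inter> ball 0 1)"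
    by (rule negligible_subset)
  then have "{x. f x \<noteq> 0} \<inter> ball 0 1 = {}"
    using open_not_negligible[OF open_Int[OF op open_ball]] by auto
  then have z: "f y = 0" if "norm y < 1" for y
    using that by auto
  \<comment> \<open>Dividing by \<open>norm x + 1\<close> brings any \<open>x\<close> into the open
    unit ball.\<close>
  have p: "0 < norm x + 1" by (simp add: add_nonneg_pos)
  have "f (inverse (norm x + 1) *\<^sub>R x) = 0"
    by (rule z) (use p in \<open>simp add: abs_of_pos divide_simps\<close>)
  then show ?thesis by (simp add: f.scaleR add_nonneg_eq_0_iff)
qed

section \<open>Minkowski inequality\<close>

text \<open>For positive arguments this is convexity of \<open>powr\<close>. If one argument is 0,
  it reduces to \<open>r powr q \<le> r\<close> for a weight \<open>r\<close> in
  \<open>(0, 1]\<close>.\<close>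

lemma powr_convex_combination_le:
  fixes x y s t q :: real
  assumes "1 \<le> q" "0 \<le> x" "0 \<le> y" "0 < s" "0 < t" "s + t = 1"
  shows "(s * x + t * y) powr q \<le> s * x powr q + t * y powr q"
proof -
  have le: "(r * z) powr q \<le> r * z powr q" if "0 < r" "r \<le> 1" "0 \<le> z" for r z :: real
    using that assms(1) powr_le_one_le[of r q]
    by (simp add: powr_mult mult_right_mono)
  show ?thesis
  proof (cases "x = 0 \<or> y = 0")
    case True
    then show ?thesis using assms le[of s x] le[of t y] by auto
  next
    case False
    then show ?thesis
      using convex_onD[OF powr_convex[OF assms(1)], of t x y] assms
      by (simp add: eq_diff_eq[symmetric])
  qed
qed

text \<open>Minkowski's inequality with positive upper bounds \<open>a\<close>, \<open>b\<close> in
  place of the two norms. The quotient \<open>(u + v) / (a + b)\<close> is the convex combination of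
  \<open>u / a\<close> and \<open>v / b\<close> with weights \<open>a / (a + b)\<close> and
  \<open>b / (a + b)\<close>; convexity is applied pointwise and then integrated.\<close>

lemma integral_powr_add_le:
  fixes u v :: "'a \<Rightarrow> real"
  assumes q: "1 \<le> q" and pos: "0 < a" "0 < b"
    and nonneg: "\<And>x. x \<in> space M \<Longrightarrow> 0 \<le> u x" "\<And>x. x \<in> space M \<Longrightarrow> 0 \<le> v x"
    and int: "integrable M (\<lambda>x. u x powr q)" "integrable M (\<lambda>x. v x powr q)"
    and le: "(LINT x|M. u x powr q) \<le> a powr q" "(LINT x|M. v x powr q) \<le> b powr q"
  shows "(LINT x|M. (u x + v x) powr q) \<le> (a + b) powr q"
proof -
  let ?w = "\<lambda>x. (a + b) powr q * (a / (a + b) * (u x powr q / a powr q) + b / (a + b) * (v x powr q / b powr q))"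
  have "(u x + v x) powr q \<le> ?w x" if x: "x \<in> space M" for x
  proof -
    have "a / (a + b) * (u x / a) + b / (a + b) * (v x / b) = (u x + v x) / (a + b)"
      using pos by (simp add: add_divide_distrib)
    then have "u x + v x = (a + b) * (a / (a + b) * (u x / a) + b / (a + b) * (v x / b))"
      using pos by simp
    then have "(u x + v x) powr q = (a + b) powr q * (a / (a + b) * (u x / a) + b / (a + b) * (v x / b)) powr q"
      using pos nonneg[OF x] by (simp only: powr_mult)
    also have "\<dots> \<le> (a + b) powr q * (a / (a + b) * (u x / a) powr q + b / (a + b) * (v x / b) powr q)"
      using pos nonneg[OF x] q
      by (intro mult_left_mono powr_convex_combination_le) (auto simp flip: add_divide_distrib)
    finally show ?thesis
      using pos nonneg[OF x] by (simp add: powr_divide)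
  qed
  then have "(LINT x|M. (u x + v x) powr q) \<le> (LINT x|M. ?w x)"
    using int pos by (intro integral_mono') auto
  also have "\<dots> = (a + b) powr q * (a / (a + b) * ((LINT x|M. u x powr q) / a powr q)
      + b / (a + b) * ((LINT x|M. v x powr q) / b powr q))"
    using int by simp
  also have "\<dots> \<le> (a + b) powr q * (a / (a + b) * 1 + b / (a + b) * 1)"
    using pos le by (intro mult_left_mono add_mono) auto
  also have "\<dots> = (a + b) powr q"
    using pos by (simp flip: add_divide_distrib)
  finally show ?thesis .
qed

section \<open>Polar decomposition and square roots of complex matrices\<close>

text \<open>By \<open>Re_cinner\<close> its real part is the Euclidean \<open>\<bullet>\<close>,
  which suffices for quadratic forms. The complex value serves the arguments that multiply vectors
  by phases.\<close>

definition cinner :: "complex ^ 'n \<Rightarrow> complex ^ 'n \<Rightarrow> complex" where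
  "cinner x y = (\<Sum>i\<in>UNIV. cnj (x $ i) * y $ i)"

lemma cinner_add_left: "cinner (x + y) z = cinner x z + cinner y z"
  by (simp add: cinner_def algebra_simps sum.distrib)

lemma cinner_add_right: "cinner x (y + z) = cinner x y + cinner x z"
  by (simp add: cinner_def algebra_simps sum.distrib)

lemma cinner_diff_left: "cinner (x - y) z = cinner x z - cinner y z"
  by (simp add: cinner_def algebra_simps sum_subtractf)

lemma cinner_diff_right: "cinner x (y - z) = cinner x y - cinner x z"
  by (simp add: cinner_def algebra_simps sum_subtractf)

lemma cinner_scale_left: "cinner (c *s x) y = cnj c * cinner x y"
  by (simp add: cinner_def sum_distrib_left ac_simps)

lemma cinner_scale_right: "cinner x (c *s y) = c * cinner x y"
  by (simp add: cinner_def sum_distrib_left ac_simps)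

lemma cnj_cinner: "cnj (cinner x y) = cinner y x"
  by (simp add: cinner_def mult.commute)

lemma Re_cinner: "Re (cinner x y) = x \<bullet> y"
  by (simp add: cinner_def inner_vec_def inner_complex_def)

lemma cinner_self: "cinner x x = of_real ((norm x)\<^sup>2)"
proof (rule complex_eqI)
  have "Im (cinner x x) = - Im (cinner x x)"
    using cnj_cinner[of x x] by (metis cnj.simps(2))
  then show "Im (cinner x x) = Im (of_real ((norm x)\<^sup>2))" by simp
qed (simp add: Re_cinner power2_norm_eq_inner)

lemma cinner_axis_left: "cinner (axis i 1) x = x $ i"
  by (simp add: cinner_def axis_def if_distrib[of cnj] if_distrib[of "\<lambda>a. a * _"] cong: if_cong)

lemma cinner_axis_right: "cinner x (axis i 1) = cnj (x $ i)"
  by (subst cnj_cinner[symmetric]) (simp add: cinner_axis_left)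

lemmas cinner_simps = cinner_add_left cinner_add_right cinner_diff_left cinner_diff_right
  cinner_scale_left cinner_scale_right

lemma matrix_vector_mult_axis_nth: "(A *v axis k 1) $ i = A $ i $ k"
  for A :: "complex ^ 'n ^ 'm"
  by (simp add: matrix_vector_mult_def axis_def if_distrib[of "\<lambda>a. _ * a"] cong: if_cong)

lemma matrix_vector_mult_scaleR_complex: "A *v (t *\<^sub>R x) = t *\<^sub>R (A *v x)"
  for A :: "complex ^ 'n ^ 'm"
  by (simp add: vec_eq_iff matrix_vector_mult_def scaleR_sum_right)

lemma adjoint_matrix_nth: "adjoint_matrix A $ i $ j = cnj (A $ j $ i)"
  by (simp add: adjoint_matrix_def transpose_def)

lemma adjoint_matrix_adjoint_matrix [simp]: "adjoint_matrix (adjoint_matrix A) = A"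
  by (simp add: vec_eq_iff adjoint_matrix_nth)

lemma adjoint_matrix_mult: "adjoint_matrix (A ** B) = adjoint_matrix B ** adjoint_matrix A"
  by (simp add: vec_eq_iff adjoint_matrix_nth matrix_matrix_mult_def mult.commute)

lemma adjoint_matrix_diff: "adjoint_matrix (A - B) = adjoint_matrix A - adjoint_matrix B"
  by (simp add: vec_eq_iff adjoint_matrix_nth)

lemma cinner_matrix_left: "cinner (A *v x) y = cinner x (adjoint_matrix A *v y)"
proof -
  have "cinner (A *v x) y = (\<Sum>i\<in>UNIV. \<Sum>j\<in>UNIV. cnj (A $ i $ j) * cnj (x $ j) * y $ i)"
    by (simp add: cinner_def matrix_vector_mult_def sum_distrib_right)
  also have "\<dots> = (\<Sum>j\<in>UNIV. \<Sum>i\<in>UNIV. cnj (A $ i $ j) * cnj (x $ j) * y $ i)"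
    by (rule sum.swap)
  also have "\<dots> = cinner x (adjoint_matrix A *v y)"
    by (simp add: cinner_def matrix_vector_mult_def sum_distrib_left adjoint_matrix_nth ac_simps)
  finally show ?thesis .
qed

lemma inner_matrix_left: "(A *v x) \<bullet> y = x \<bullet> (adjoint_matrix A *v y)"
  for A :: "complex ^ 'n ^ 'm"
  by (simp flip: Re_cinner add: cinner_matrix_left)

section \<open>Positive semidefinite forms and uniqueness of square roots\<close>

lemma psd_matrix_iff:
  "psd_matrix A \<longleftrightarrow> adjoint_matrix A = A \<and> (\<forall>x. 0 \<le> x \<bullet> (A *v x))"
  by (simp add: psd_matrix_def cinner_def flip: Re_cinner)

lemma psd_matrix_adjoint: "psd_matrix A \<Longrightarrow> adjoint_matrix A = A"
  by (simp add: psd_matrix_iff)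

lemma psd_matrix_nonneg: "psd_matrix A \<Longrightarrow> 0 \<le> x \<bullet> (A *v x)"
  by (simp add: psd_matrix_iff)

text \<open>If \<open>y = P *v x\<close> were nonzero, the form at \<open>x - t *\<^sub>R y\<close>,
  which is \<open>t\<^sup>2 * c - 2 * t * (y \<bullet> y)\<close>, would be negative for a suitable
  \<open>t\<close>.\<close>

lemma psd_matrix_mult_eq_0:
  assumes P: "psd_matrix P" and x: "x \<bullet> (P *v x) = 0"
  shows "P *v x = 0"
proof (rule ccontr)
  assume nz: "P *v x \<noteq> 0"
  define y where "y = P *v x"
  define c where "c = y \<bullet> (P *v y)"
  have le: "2 * t * (y \<bullet> y) \<le> t\<^sup>2 * c" for t
  proof -
    have "0 \<le> (x - t *\<^sub>R y) \<bullet> (P *v (x - t *\<^sub>R y))"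
      using P by (rule psd_matrix_nonneg)
    also have "\<dots> = t\<^sup>2 * c - t * (y \<bullet> (P *v x)) - t * (x \<bullet> (P *v y))"
      using x by (simp add: matrix_vector_mult_diff_distrib matrix_vector_mult_scaleR_complex
          inner_diff_left inner_diff_right c_def power2_eq_square
          right_diff_distrib)
    also have "x \<bullet> (P *v y) = y \<bullet> y"
      using inner_matrix_left[of P x y] psd_matrix_adjoint[OF P] by (simp add: y_def)
    finally show ?thesis by (simp add: y_def)
  qed
  have pos: "0 < y \<bullet> y" using nz by (simp add: y_def)
  have "2 * (y \<bullet> y) \<le> c" using le[of 1] by simp
  with pos have "0 < c" by linarith
  \<comment> \<open>The choice \<open>t = (y \<bullet> y) / c\<close> minimises this quadratic
    polynomial.\<close>
  then have "2 * ((y \<bullet> y) * (y \<bullet> y) / c) \<le> (y \<bullet> y) * (y \<bullet> y) / c"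
    using le[of "y \<bullet> y / c"] by (simp add: power2_eq_square)
  moreover have "0 < (y \<bullet> y) * (y \<bullet> y) / c"
    using pos \<open>0 < c\<close> by (intro divide_pos_pos mult_pos_pos)
  ultimately show False by linarith
qed

text \<open>For \<open>D = B - C\<close> the hypothesis gives \<open>B ** D + D ** C = 0\<close>.
  Multiplying by \<open>D\<close> and taking traces yields a vanishing sum of nonnegative values of
  the forms of \<open>B\<close> and \<open>C\<close> at the columns of \<open>D\<close>. Hence
  \<open>B\<close> and \<open>C\<close> kill these columns, so \<open>D ** D = 0\<close>, and
  \<open>D\<close> is Hermitian.\<close>

lemma psd_matrix_sqrt_unique:
  assumes B: "psd_matrix B" and C: "psd_matrix C" and eq: "B ** B = C ** C"
  shows "B = C"
proof -
  define D where "D = B - C"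
  have D: "adjoint_matrix D = D"
    using B C by (simp add: D_def adjoint_matrix_diff psd_matrix_adjoint)
  have "B *v (B *v x) = C *v (C *v x)" for x
    by (simp add: matrix_vector_mul_assoc eq)
  then have "B ** D + D ** C = 0"
    by (simp add: matrix_eq D_def matrix_vector_mult_diff_distrib
        matrix_vector_mult_diff_rdistrib matrix_vector_mult_add_rdistrib
        flip: matrix_vector_mul_assoc)
  then have "D ** (B ** D) + D ** (D ** C) = D ** 0"
    by (simp flip: matrix_add_ldistrib)
  also have "D ** 0 = 0"
    by (simp add: matrix_matrix_mult_def vec_eq_iff)
  finally have "D ** (B ** D) + D ** (D ** C) = 0" .
  then have "trace (D ** (B ** D)) + trace (D ** (D ** C)) = 0"
    using trace_0 by (simp flip: trace_add)
  moreover have "trace (D ** (D ** C)) = trace (D ** (C ** D))"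
    using trace_mul_sym[of D "D ** C"] by (simp add: matrix_mul_assoc)
  moreover have tr: "Re (trace (D ** (X ** D))) = (\<Sum>i\<in>UNIV. (D *v axis i 1) \<bullet> (X *v (D *v axis i 1)))"
    for X
  proof -
    have "Re (trace (D ** (X ** D))) = (\<Sum>i\<in>UNIV. axis i 1 \<bullet> (D *v (X *v (D *v axis i 1))))"
      by (simp add: trace_def matrix_vector_mul_assoc cinner_axis_left matrix_vector_mult_axis_nth
          matrix_mul_assoc flip: Re_cinner)
    then show ?thesis
      using inner_matrix_left[of D] by (simp add: D)
  qed
  ultimately have "(\<Sum>i\<in>UNIV. (D *v axis i 1) \<bullet> (B *v (D *v axis i 1))) +
      (\<Sum>i\<in>UNIV. (D *v axis i 1) \<bullet> (C *v (D *v axis i 1))) = 0"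
    by (metis tr plus_complex.sel(1) zero_complex.sel(1))
  then have "(D *v axis i 1) \<bullet> (B *v (D *v axis i 1)) = 0 \<and> (D *v axis i 1) \<bullet> (C *v (D *v axis i 1)) = 0" for i
    using psd_matrix_nonneg[OF B] psd_matrix_nonneg[OF C]
    by (simp add: add_nonneg_eq_0_iff sum_nonneg sum_nonneg_eq_0_iff)
  then have "B *v (D *v axis i 1) = 0 \<and> C *v (D *v axis i 1) = 0" for i
    using psd_matrix_mult_eq_0 B C by blast
  then have "D *v (D *v axis i 1) = 0" for i
    by (simp add: D_def matrix_vector_mult_diff_rdistrib)
  then have "(D *v axis i 1) \<bullet> (D *v axis i 1) = 0" for i
    by (simp add: inner_matrix_left D)
  then have "D *v axis i 1 = 0" for i by simp
  then have "D = 0"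
    by (auto simp: vec_eq_iff matrix_vector_mult_axis_nth)
  then show ?thesis by (simp add: D_def)
qed


text \<open>Polarization: the form at \<open>x + y\<close> controls the imaginary part of
  \<open>b x y + b y x\<close>, and replacing \<open>y\<close> by \<open>\<i> *s y\<close> controls
  the real part of \<open>b x y - b y x\<close>.\<close>

lemma adjoint_matrix_eqI:
  assumes "\<And>x. Im (cinner x (P *v x)) = 0"
  shows "adjoint_matrix P = P"
proof -
  define b where "b x y = cinner x (P *v y)" for x y
  have im: "Im (b x y + b y x) = 0" for x y
    using assms[of "x + y"] assms[of x] assms[of y]
    by (simp add: b_def cinner_simps matrix_vector_right_distrib)
  have re: "Re (b x y - b y x) = 0" for x y
    using im[of x "\<i> *s y"] by (simp add: b_def vector_scalar_commute cinner_simps)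
  have "cnj (b x y) = b y x" for x y
    using im[of x y] re[of x y] by (simp add: complex_eq_iff)
  from this[of "axis i 1" "axis j 1" for i j] have "cnj (P $ i $ j) = P $ j $ i" for i j
    by (simp add: b_def cinner_axis_left matrix_vector_mult_axis_nth)
  then show ?thesis
    by (simp add: vec_eq_iff adjoint_matrix_nth)
qed

text \<open>For a unit vector \<open>x\<close>, this multiplies the component along \<open>x\<close>
  by \<open>z\<close> and fixes the orthogonal complement of \<open>x\<close>.\<close>

definition phase_reflection :: "complex ^ 'n \<Rightarrow> complex \<Rightarrow> complex ^ 'n ^ 'n" where
  "phase_reflection x z = (\<chi> i j. (if i = j then 1 else 0) + (z - 1) * x $ i * cnj (x $ j))"

lemma phase_reflection_mult_vec:
  "phase_reflection x z *v y = y + ((z - 1) * cinner x y) *s x"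
  by (simp add: vec_eq_iff phase_reflection_def matrix_vector_mult_def cinner_def distrib_right distrib_left
      sum.distrib sum_distrib_left sum_distrib_right if_distrib[of "\<lambda>a. _ * a"] ac_simps cong: if_cong)

lemma unitary_phase_reflection:
  assumes x: "norm x = 1" and z: "cmod z = 1"
  shows "unitary_matrix (phase_reflection x z)"
proof -
  have adj: "adjoint_matrix (phase_reflection x z) = phase_reflection x (cnj z)"
    by (auto simp: vec_eq_iff adjoint_matrix_nth phase_reflection_def)
  have mult: "phase_reflection x v ** phase_reflection x w = mat 1" if "v * w = 1" for v w
  proof -
    \<comment> \<open>With \<open>c = cinner x y\<close>, this is the coefficient of
      \<open>x\<close> that the product of the two reflections adds to \<open>y\<close>.\<close>
    have "(w - 1) * c + (v - 1) * (c + (w - 1) * c) = (v * w - 1) * c" for c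
      by (simp add: algebra_simps)
    then have "(w - 1) * c + (v - 1) * (c + (w - 1) * c) = 0" for c
      using that by simp
    then show ?thesis
      by (simp add: matrix_eq phase_reflection_mult_vec cinner_simps cinner_self x add.assoc
          flip: matrix_vector_mul_assoc vector_sadd_rdistrib)
  qed
  have "z * cnj z = 1"
    using z by (simp add: complex_norm_square[symmetric])
  then show ?thesis
    using mult[of z "cnj z"] mult[of "cnj z" z] by (simp add: unitary_matrix_def adj mult.commute)
qed

lemma trace_phase_reflection_mult:
  "trace (phase_reflection x z ** P) = trace P + (z - 1) * cinner x (P *v x)"
proof -
  have "trace (phase_reflection x z ** P) = trace (P ** phase_reflection x z)"
    by (rule trace_mul_sym)
  also have "\<dots> = (\<Sum>i\<in>UNIV. cinner (axis i 1) (P *v (phase_reflection x z *v axis i 1)))"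
    by (simp add: trace_def cinner_axis_left matrix_vector_mul_assoc matrix_vector_mult_axis_nth)
  also have "\<dots> = trace P + (\<Sum>i\<in>UNIV. (z - 1) * cnj (x $ i) * (P *v x) $ i)"
    by (simp add: phase_reflection_mult_vec matrix_vector_right_distrib vector_scalar_commute
        cinner_simps sum.distrib trace_def cinner_axis_left cinner_axis_right
        matrix_vector_mult_axis_nth)
  also have "\<dots> = trace P + (z - 1) * cinner x (P *v x)"
    by (simp add: cinner_def sum_distrib_left ac_simps)
  finally show ?thesis .
qed

lemma unitary_matrix_mult:
  "unitary_matrix U \<Longrightarrow> unitary_matrix V \<Longrightarrow> unitary_matrix (U ** V)"
proof -
  assume U: "unitary_matrix U" and V: "unitary_matrix V"
  have "adjoint_matrix (U ** V) ** (U ** V) = adjoint_matrix V ** (adjoint_matrix U ** U) ** V"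
    by (simp add: adjoint_matrix_mult matrix_mul_assoc)
  moreover have "U ** V ** adjoint_matrix (U ** V) = U ** (V ** adjoint_matrix V) ** adjoint_matrix U"
    by (simp add: adjoint_matrix_mult matrix_mul_assoc)
  ultimately show ?thesis
    using U V by (simp add: unitary_matrix_def)
qed

lemma unitary_matrix_adjoint: "unitary_matrix U \<Longrightarrow> unitary_matrix (adjoint_matrix U)"
  by (auto simp: unitary_matrix_def)

lemma norm_unitary_matrix_mult_vec: "unitary_matrix U \<Longrightarrow> norm (U *v x) = norm x"
  by (simp add: norm_eq_sqrt_inner inner_matrix_left matrix_vector_mul_assoc unitary_matrix_def)

text \<open>Closed, because a one-sided inverse of a square matrix is two-sided and a single
  continuous equation defines the set; bounded, because the rows are unit vectors.\<close>

lemma compact_unitary_matrices: "compact {U :: complex ^ 'n ^ 'n. unitary_matrix U}"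
proof -
  have eq: "unitary_matrix U \<longleftrightarrow> adjoint_matrix U ** U = mat 1" for U :: "complex ^ 'n ^ 'n"
    using matrix_left_right_inverse by (auto simp: unitary_matrix_def)
  have "continuous_on UNIV (\<lambda>U :: complex ^ 'n ^ 'n. adjoint_matrix U ** U)"
    unfolding matrix_matrix_mult_def adjoint_matrix_def map_matrix_def transpose_def
    by (intro continuous_intros continuous_on_vec_lambda)
  then have "closed {U :: complex ^ 'n ^ 'n. unitary_matrix U}"
    unfolding eq by (intro closed_Collect_eq continuous_intros)
  moreover have "norm U \<le> (\<Sum>i\<in>(UNIV :: 'n set). 1)" if U: "unitary_matrix U" for U :: "complex ^ 'n ^ 'n"
  proof -
    have "norm (U $ i) = 1" for i
    proof -
      have "(U ** adjoint_matrix U) $ i $ i = cinner (U $ i) (U $ i)"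
        by (simp add: matrix_matrix_mult_def adjoint_matrix_nth cinner_def mult.commute)
      then show ?thesis
        using U by (simp add: unitary_matrix_def cinner_self mat_def
            flip: of_real_power) (metis of_real_eq_1_iff norm_ge_zero one_power2 power2_eq_imp_eq zero_le_one)
    qed
    then show ?thesis
      unfolding norm_vec_def[of U] using L2_set_le_sum[of UNIV "\<lambda>i. norm (U $ i)"] by simp
  qed
  ultimately show ?thesis
    unfolding compact_eq_bounded_closed bounded_iff by blast
qed

text \<open>
  The unitary factor is a maximiser of \<open>Re (trace (U ** A))\<close>: comparing it with its products with
  phase reflections forces the quadratic form of \<open>U ** A\<close> to be real and nonnegative.
\<close>

lemma polar_decomposition:
  fixes A :: "complex ^ 'n ^ 'n"
  obtains U where "unitary_matrix U" "psd_matrix (U ** A)"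
proof -
  have "continuous_on {U. unitary_matrix U} (\<lambda>U. Re (trace (U ** A)))"
    unfolding trace_def matrix_matrix_mult_def
    by (simp, intro continuous_intros)
  moreover have "unitary_matrix (mat 1 :: complex ^ 'n ^ 'n)"
    by (simp add: unitary_matrix_def adjoint_matrix_def transpose_mat)
      (simp add: vec_eq_iff mat_def)
  ultimately obtain U where U: "unitary_matrix U"
    and max: "\<And>V. unitary_matrix V \<Longrightarrow> Re (trace (V ** A)) \<le> Re (trace (U ** A))"
    using continuous_attains_sup[OF compact_unitary_matrices] by (metis empty_iff mem_Collect_eq)
  define P where "P = U ** A"
  have unit: "cinner x (P *v x) = of_real (cmod (cinner x (P *v x)))" if x: "norm x = 1" for x
  proof (cases "cinner x (P *v x) = 0")
    case False
    define w where "w = cinner x (P *v x)"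
    \<comment> \<open>The phase that rotates \<open>w\<close> onto the nonnegative real axis;
      maximality then gives \<open>cmod w \<le> Re w\<close>.\<close>
    define z where "z = cnj w / of_real (cmod w)"
    have z: "cmod z = 1" "z * w = of_real (cmod w)"
      using False by (simp_all add: z_def w_def norm_divide complex_norm_square[symmetric]
          power2_eq_square mult.commute[of "cnj _"])
    have "Re (trace (phase_reflection x z ** P)) \<le> Re (trace P)"
      using max[of "phase_reflection x z ** U"] unitary_phase_reflection[OF x z(1)] U
      by (simp add: P_def unitary_matrix_mult matrix_mul_assoc)
    then have "Re ((z - 1) * w) \<le> 0"
      by (simp add: trace_phase_reflection_mult w_def)
    then have "cmod w \<le> Re w"
      by (simp add: left_diff_distrib z(2))
    then have "Re w = cmod w"
      using complex_Re_le_cmod[of w] by simp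
    moreover from this have "Im w = 0"
      using cmod_power2[of w] by simp
    ultimately show ?thesis
      by (simp add: complex_eq_iff flip: w_def)
  qed simp
  have real: "cinner x (P *v x) = of_real (cmod (cinner x (P *v x)))" for x
  proof (cases "x = 0")
    case False
    define u where "u = (1 / of_real (norm x)) *s x"
    have "cinner u u = 1"
      using False unfolding u_def cinner_simps by (simp add: cinner_self power2_eq_square)
    then have "norm u = 1"
      using norm_ge_zero[of u]
      by (simp add: cinner_self power2_eq_1_iff flip: of_real_power)
    from unit[OF this] show ?thesis
      using False
      by (simp add: u_def vector_scalar_commute cinner_simps norm_mult norm_divide
          divide_simps)
  qed (simp add: cinner_def)
  have "psd_matrix P"
    unfolding psd_matrix_iff
  proof (intro conjI allI adjoint_matrix_eqI)
    show "Im (cinner x (P *v x)) = 0" for x using real[of x] by (metis Im_complex_of_real)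
    show "0 \<le> x \<bullet> (P *v x)" for x
      using real[of x] by (metis Re_cinner Re_complex_of_real norm_ge_zero)
  qed
  with U that show thesis by (simp add: P_def)
qed

lemma adjoint_matrix_diag_real: "adjoint_matrix P = P \<Longrightarrow> cinner x (P *v x) = of_real (x \<bullet> (P *v x))"
proof -
  assume "adjoint_matrix P = P"
  then have "cnj (cinner x (P *v x)) = cinner x (P *v x)"
    by (simp add: cnj_cinner cinner_matrix_left)
  then have "Im (cinner x (P *v x)) = 0"
    by (metis Reals_cnj_iff complex_is_Real_iff)
  then show ?thesis
    by (simp add: complex_eq_iff Re_cinner)
qed

text \<open>
  One step of the Cholesky factorisation: subtracting \<open>v v\<^sup>*\<close> from \<open>P\<close> leaves the Schur complement
  of the diagonal entry \<open>j\<close>, whose form at \<open>x\<close> is that of \<open>P\<close> at \<open>x - c e\<^sub>j\<close>.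
\<close>

lemma psd_matrix_schur_step:
  fixes P :: "complex ^ 'n ^ 'n"
  assumes P: "psd_matrix P"
  obtains Q v where "psd_matrix Q" "\<And>x. P *v x = Q *v x + cinner v x *s v"
    "Q *v axis j 1 = 0" "\<And>y. P *v y = 0 \<Longrightarrow> Q *v y = 0"
proof (cases "P *v axis j 1 = 0")
  case True
  then show ?thesis using that[of P 0] P by (simp add: cinner_def)
next
  case False
  define e where "e = (axis j 1 :: complex ^ 'n)"
  define w where "w = P *v e"
  define d where "d = e \<bullet> w"
  have adj: "adjoint_matrix P = P" using P by (rule psd_matrix_adjoint)
  have "0 \<le> d" "d \<noteq> 0"
    using psd_matrix_nonneg[OF P, of e] psd_matrix_mult_eq_0[OF P, of e] False
    by (auto simp: d_def w_def e_def)
  then have d: "0 < d" by simp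
  have ew: "cinner e w = of_real d"
    using adjoint_matrix_diag_real[OF adj] by (simp add: d_def w_def)
  \<comment> \<open>Scaled so that \<open>v\<close> times its adjoint is \<open>w\<close> times its
    adjoint divided by \<open>d\<close>, which agrees with \<open>P\<close> in column
    \<open>j\<close>.\<close>
  define v where "v = (1 / of_real (sqrt d)) *s w"
  define Q where "Q = P - (\<chi> i k. v $ i * cnj (v $ k))"
  have "(\<chi> i k. v $ i * cnj (v $ k)) *v x = cinner v x *s v" for x
    by (simp add: vec_eq_iff matrix_vector_mult_def cinner_def sum_distrib_left sum_distrib_right ac_simps)
  then have Qv: "Q *v x = P *v x - cinner v x *s v" for x
    by (simp add: Q_def matrix_vector_mult_diff_rdistrib)
  have "complex_of_real (sqrt d) * complex_of_real (sqrt d) = of_real d"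
    using d by (simp flip: of_real_mult)
  then have vv: "cinner v x *s v = (cinner w x / of_real d) *s w" for x
    by (simp add: v_def cinner_simps)
  have Q: "Q *v x = P *v x - (cinner w x / of_real d) *s w" for x
    by (simp add: Qv vv)
  have we: "cinner w x = cinner e (P *v x)" for x
    by (simp add: w_def cinner_matrix_left adj)
  show thesis
  proof (rule that)
    show "psd_matrix Q"
      unfolding psd_matrix_iff
    proof (intro conjI allI)
      have "adjoint_matrix (\<chi> i k. v $ i * cnj (v $ k)) = (\<chi> i k. v $ i * cnj (v $ k))"
        by (simp add: vec_eq_iff adjoint_matrix_nth)
      then show "adjoint_matrix Q = Q"
        by (simp add: Q_def adjoint_matrix_diff adj)
      fix x
      \<comment> \<open>For this \<open>c\<close> one has \<open>Q *v x = P *v (x - c *s e)\<close>,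
        and this vector is orthogonal to \<open>e\<close>.\<close>
      define c where "c = cinner w x / of_real d"
      have wx: "cinner w x = c * of_real d"
        using d by (simp add: c_def)
      have xw: "cinner x w = cnj c * of_real d"
        using arg_cong[OF wx, of cnj] by (simp add: cnj_cinner)
      have eP: "cinner e (P *v x) = c * of_real d"
        using wx we by simp
      have "cinner (x - c *s e) (P *v (x - c *s e)) = cinner x (Q *v x)"
        by (simp add: Q matrix_vector_mult_diff_distrib vector_scalar_commute cinner_simps
            ew xw eP flip: w_def c_def)
      then show "0 \<le> x \<bullet> (Q *v x)"
        using psd_matrix_nonneg[OF P, of "x - c *s e"] by (metis Re_cinner)
    qed
    show "P *v x = Q *v x + cinner v x *s v" for x
      by (simp add: Qv)
    show "Q *v axis j 1 = 0"
      using d arg_cong[OF ew, of cnj] by (simp add: Q cnj_cinner flip: e_def w_def)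
    show "Q *v y = 0" if "P *v y = 0" for y
      using that by (simp add: Q we) (simp add: cinner_def)
  qed
qed

text \<open>Each Schur step clears one column and enlarges the kernel, so columns cleared earlier
  stay zero. Once all are cleared, \<open>P\<close> is a sum of rank-one terms, whose vectors give
  the conjugated rows of \<open>A\<close>.\<close>

lemma psd_matrix_cholesky:
  fixes P :: "complex ^ 'n ^ 'n"
  assumes P: "psd_matrix P"
  obtains A :: "complex ^ 'n ^ 'n" where "P = adjoint_matrix A ** A"
proof -
  have *: "\<exists>Q v. psd_matrix Q \<and> (\<forall>i\<in>S. Q *v axis i 1 = 0) \<and>
      (\<forall>x. P *v x = Q *v x + (\<Sum>i\<in>S. cinner (v i) x *s v i))" if "finite S" for S
    using that
  proof induction
    case empty
    then show ?case using P by (intro exI[of _ P]) simp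
  next
    case (insert j S)
    then obtain Q v where Q: "psd_matrix Q" "\<And>i. i \<in> S \<Longrightarrow> Q *v axis i 1 = 0"
      "\<And>x. P *v x = Q *v x + (\<Sum>i\<in>S. cinner (v i) x *s v i)"
      by blast
    obtain R u where R: "psd_matrix R" "\<And>x. Q *v x = R *v x + cinner u x *s u"
      "R *v axis j 1 = 0" "\<And>y. Q *v y = 0 \<Longrightarrow> R *v y = 0"
      using psd_matrix_schur_step[OF Q(1), of j] by metis
    have "(\<Sum>i\<in>S. cinner ((v(j := u)) i) x *s (v(j := u)) i) = (\<Sum>i\<in>S. cinner (v i) x *s v i)" for x
      using insert.hyps by (intro sum.cong) auto
    then show ?case
      using R Q insert.hyps
      by (intro exI[of _ R] exI[of _ "v(j := u)"]) (auto simp: add.assoc)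
  qed
  obtain Q v where Q0: "\<forall>i\<in>UNIV. Q *v axis i 1 = 0"
    and Pv: "\<forall>x. P *v x = Q *v x + (\<Sum>i\<in>(UNIV :: 'n set). cinner (v i) x *s v i)"
    using *[OF finite_class.finite_UNIV] by blast
  from Q0 have "(Q *v axis i 1) $ k = 0" for i k by simp
  then have "Q = 0"
    by (simp add: vec_eq_iff matrix_vector_mult_axis_nth)
  define A :: "complex ^ 'n ^ 'n" where "A = (\<chi> i k. cnj (v i $ k))"
  have "(A *v x) $ i = cinner (v i) x" for x i
    by (simp add: A_def matrix_vector_mult_def cinner_def)
  moreover have "adjoint_matrix A *v y = (\<Sum>i\<in>UNIV. y $ i *s v i)" for y
    by (simp add: vec_eq_iff A_def matrix_vector_mult_def adjoint_matrix_nth mult.commute)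
  ultimately have "P = adjoint_matrix A ** A"
    by (simp add: matrix_eq Pv \<open>Q = 0\<close> flip: matrix_vector_mul_assoc)
  then show thesis by (rule that)
qed

section \<open>Existence of absolute values and square roots\<close>

lemma sqrt_matrix_eqI:
  assumes "psd_matrix B" "B ** B = P"
  shows "sqrt_matrix P = B"
  unfolding sqrt_matrix_def using assms psd_matrix_sqrt_unique by blast

lemma unitary_polar_square:
  assumes "unitary_matrix U" "psd_matrix (U ** A)"
  shows "(U ** A) ** (U ** A) = adjoint_matrix A ** A"
proof -
  have "(U ** A) ** (U ** A) = adjoint_matrix A ** (adjoint_matrix U ** U) ** A"
    using psd_matrix_adjoint[OF assms(2)]
    by (metis adjoint_matrix_mult matrix_mul_assoc)
  then show ?thesis
    using assms(1) by (simp add: unitary_matrix_def)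
qed

lemma abs_matrix_eqI:
  assumes "psd_matrix B" "B ** B = adjoint_matrix A ** A"
  shows "abs_matrix A = B"
  unfolding abs_matrix_def using assms by (rule sqrt_matrix_eqI)

text \<open>The positive semidefinite product \<open>U ** A\<close> squares to
  \<open>adjoint_matrix A ** A\<close>, so the polar decomposition supplies the root that defines
  \<open>abs_matrix A\<close>.\<close>

lemma abs_matrix_polar:
  obtains U where "unitary_matrix U" "abs_matrix A = U ** A" "psd_matrix (abs_matrix A)"
  by (metis polar_decomposition unitary_polar_square abs_matrix_eqI)

lemma psd_abs_matrix: "psd_matrix (abs_matrix A)"
  by (metis abs_matrix_polar)

lemma abs_matrix_square: "abs_matrix A ** abs_matrix A = adjoint_matrix A ** A"
  by (metis abs_matrix_polar unitary_polar_square)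

text \<open>A Cholesky factor \<open>A\<close> of \<open>P\<close> turns the square root of
  \<open>P\<close> into \<open>abs_matrix A\<close>, whose properties are known.\<close>

lemma psd_sqrt_matrix:
  fixes P :: "complex ^ 'n ^ 'n"
  assumes "psd_matrix P"
  shows "psd_matrix (sqrt_matrix P)" and "sqrt_matrix P ** sqrt_matrix P = P"
proof -
  obtain A :: "complex ^ 'n ^ 'n" where A: "P = adjoint_matrix A ** A"
    using psd_matrix_cholesky[OF assms] by blast
  then have "sqrt_matrix P = abs_matrix A" by (simp add: abs_matrix_def)
  then show "psd_matrix (sqrt_matrix P)" "sqrt_matrix P ** sqrt_matrix P = P"
    using A by (simp_all add: psd_abs_matrix abs_matrix_square)
qed

lemma norm_sqrt_matrix_mult_vec:
  assumes "psd_matrix P"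
  shows "(norm (sqrt_matrix P *v x))\<^sup>2 = x \<bullet> (P *v x)"
  using psd_sqrt_matrix[OF assms]
  by (simp add: power2_norm_eq_inner inner_matrix_left psd_matrix_adjoint matrix_vector_mul_assoc)

section \<open>The norms\<close>

lemma orthogonal_transformation_unitary:
  "unitary_matrix U \<Longrightarrow> orthogonal_transformation ((*v) U)"
  unfolding orthogonal_transformation
  by (auto simp: norm_unitary_matrix_mult_vec intro: bounded_linear.linear)

lemma continuous_on_quadratic_form_powr:
  assumes "psd_matrix P" "0 < q"
  shows "continuous_on UNIV (\<lambda>x. (x \<bullet> (P *v x)) powr q)"
  using assms by (intro continuous_on_powr' continuous_intros linear_continuous_on)
    (auto simp: psd_matrix_nonneg)

lemma norm_N_eq:
  "norm_N q A = (LINT x|sphere_measure. (x \<bullet> (abs_matrix A *v x)) powr q) powr (1 / q)"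
proof -
  have "norm (sqrt_matrix (abs_matrix A) *v x) powr (2 * q) = (x \<bullet> (abs_matrix A *v x)) powr q" for x
    unfolding norm_sqrt_matrix_mult_vec[OF psd_abs_matrix, symmetric] powr_powr[symmetric]
    by (simp add: powr_numeral)
  then show ?thesis
    by (simp add: norm_N_def)
qed

lemma norm_N_powr:
  assumes "1 \<le> q"
  shows "norm_N q A powr q = (LINT x|sphere_measure. (x \<bullet> (abs_matrix A *v x)) powr q)"
  using assms by (simp add: norm_N_eq powr_powr integral_nonneg_AE)

lemma norm_N_nonneg: "0 \<le> norm_N q A"
  by (simp add: norm_N_def)

lemma matrix_eq_unitary_abs:
  obtains U where "unitary_matrix U" "A = U ** abs_matrix A"
proof -
  obtain U where U: "unitary_matrix U" "abs_matrix A = U ** A"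
    using abs_matrix_polar by metis
  then have "adjoint_matrix U ** abs_matrix A = A"
    by (simp add: matrix_mul_assoc unitary_matrix_def)
  then show thesis
    using that unitary_matrix_adjoint[OF U(1)] by metis
qed

text \<open>A vanishing integral makes the form of \<open>abs_matrix A\<close> zero almost
  everywhere, hence also the vector \<open>abs_matrix A *v x\<close>. By linearity
  \<open>abs_matrix A = 0\<close>, and \<open>A\<close> is a unitary multiple of it.\<close>

lemma norm_N_eq_0_iff:
  fixes A :: "complex ^ 'n ^ 'n"
  assumes q: "1 \<le> q"
  shows "norm_N q A = 0 \<longleftrightarrow> A = 0"
proof
  assume "norm_N q A = 0"
  then have "(LINT x|sphere_measure. (x \<bullet> (abs_matrix A *v x)) powr q) = 0"
    using norm_N_powr[OF q, of A] by simp
  moreover have "integrable sphere_measure (\<lambda>x. (x \<bullet> (abs_matrix A *v x)) powr q)"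
    using q by (intro integrable_sphere_measure continuous_on_quadratic_form_powr psd_abs_matrix) simp
  ultimately have "AE x in sphere_measure. (x \<bullet> (abs_matrix A *v x)) powr q = 0"
    by (subst (asm) integral_nonneg_eq_0_iff_AE) auto
  then have "AE x in sphere_measure. abs_matrix A *v x = 0"
    by eventually_elim (simp add: psd_matrix_mult_eq_0 psd_abs_matrix)
  then have "abs_matrix A *v x = 0" for x
    by (intro linear_zero_if_AE_sphere_zero matrix_vector_mul_bounded_linear)
  then have "abs_matrix A = 0"
    by (simp add: matrix_eq)
  then show "A = 0"
    using matrix_eq_unitary_abs[of A] by (metis matrix_eq matrix_vector_mul_assoc matrix_vector_mult_0 matrix_vector_mult_0_right)
next
  assume "A = 0"
  have "abs_matrix (0 :: complex ^ 'n ^ 'n) = 0"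
    by (rule abs_matrix_eqI) (simp_all add: psd_matrix_iff vec_eq_iff adjoint_matrix_nth
        matrix_matrix_mult_def)
  then show "norm_N q A = 0"
    using \<open>A = 0\<close> by (simp add: norm_N_eq)
qed

text \<open>The absolute value of the multiple is \<open>cmod c\<close> times that of
  \<open>A\<close>, by uniqueness of the positive root.\<close>

lemma norm_N_scale:
  fixes A :: "complex ^ 'n ^ 'n"
  assumes q: "1 \<le> q"
  shows "norm_N q (map_matrix ((*) c) A) = cmod c * norm_N q A"
proof -
  have mult: "map_matrix ((*) a) X *v x = a *s (X *v x)" for a x and X :: "complex ^ 'n ^ 'n"
    by (simp add: vec_eq_iff matrix_vector_mult_def sum_distrib_left mult.assoc)
  have adj: "adjoint_matrix (map_matrix ((*) a) X) = map_matrix ((*) (cnj a)) (adjoint_matrix X)"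
    for a and X :: "complex ^ 'n ^ 'n"
    by (simp add: vec_eq_iff adjoint_matrix_nth)
  have form: "x \<bullet> (map_matrix ((*) (complex_of_real t)) X *v x) = t * (x \<bullet> (X *v x))"
    for t x and X :: "complex ^ 'n ^ 'n"
    by (simp add: mult cinner_simps flip: Re_cinner)
  have "abs_matrix (map_matrix ((*) c) A) = map_matrix ((*) (complex_of_real (cmod c))) (abs_matrix A)"
  proof (rule abs_matrix_eqI)
    show "psd_matrix (map_matrix ((*) (complex_of_real (cmod c))) (abs_matrix A))"
      using psd_abs_matrix[of A] by (simp add: psd_matrix_iff adj form)
    have "abs_matrix A *v (abs_matrix A *v x) = adjoint_matrix A *v (A *v x)" for x
      by (simp add: matrix_vector_mul_assoc abs_matrix_square)
    moreover have "complex_of_real (cmod c) * complex_of_real (cmod c) = c * cnj c"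
      using complex_norm_square[of c] by (simp add: power2_eq_square mult.commute)
    ultimately show "map_matrix ((*) (complex_of_real (cmod c))) (abs_matrix A) **
        map_matrix ((*) (complex_of_real (cmod c))) (abs_matrix A) =
        adjoint_matrix (map_matrix ((*) c) A) ** map_matrix ((*) c) A"
      by (simp add: matrix_eq mult adj vector_scalar_commute vector_smult_assoc
          flip: matrix_vector_mul_assoc)
  qed
  then show ?thesis
    using q by (simp add: norm_N_eq form powr_mult psd_matrix_nonneg psd_abs_matrix
        integral_nonneg_AE powr_powr)
qed

text \<open>The factor \<open>U\<close> cancels in \<open>abs_matrix (U ** A ** V)\<close>, while
  \<open>V\<close> conjugates \<open>abs_matrix A\<close>. The form at \<open>x\<close> thus becomes
  the form of \<open>abs_matrix A\<close> at \<open>V *v x\<close>, and rotation invariance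
  applies.\<close>

lemma norm_N_unitary:
  fixes A :: "complex ^ 'n ^ 'n"
  assumes q: "1 \<le> q" and U: "unitary_matrix U" and V: "unitary_matrix V"
  shows "norm_N q (U ** A ** V) = norm_N q A"
proof -
  have cancel: "adjoint_matrix U ** (U ** X) = X" "V ** (adjoint_matrix V ** X) = X"
    for X :: "complex ^ 'n ^ 'n"
    using U V by (simp_all add: matrix_mul_assoc unitary_matrix_def)
  have form: "x \<bullet> ((adjoint_matrix V ** abs_matrix A ** V) *v x) = (V *v x) \<bullet> (abs_matrix A *v (V *v x))"
    for x
    by (simp add: inner_matrix_left matrix_vector_mul_assoc matrix_mul_assoc)
  have "abs_matrix (U ** A ** V) = adjoint_matrix V ** abs_matrix A ** V"
  proof (rule abs_matrix_eqI)
    show "psd_matrix (adjoint_matrix V ** abs_matrix A ** V)"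
      using psd_abs_matrix[of A]
      by (simp add: psd_matrix_iff form adjoint_matrix_mult matrix_mul_assoc)
    have "abs_matrix A ** (abs_matrix A ** X) = adjoint_matrix A ** (A ** X)" for X :: "complex ^ 'n ^ 'n"
      by (simp add: matrix_mul_assoc abs_matrix_square)
    then show "adjoint_matrix V ** abs_matrix A ** V ** (adjoint_matrix V ** abs_matrix A ** V) =
        adjoint_matrix (U ** A ** V) ** (U ** A ** V)"
      by (simp add: adjoint_matrix_mult cancel flip: matrix_mul_assoc)
  qed
  moreover have "(LINT x|sphere_measure. ((V *v x) \<bullet> (abs_matrix A *v (V *v x))) powr q) =
      (LINT x|sphere_measure. (x \<bullet> (abs_matrix A *v x)) powr q)"
    using q by (intro integral_sphere_measure_orthogonal orthogonal_transformation_unitary V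
        borel_measurable_sphere_measure continuous_on_quadratic_form_powr psd_abs_matrix) simp
  ultimately show ?thesis
    by (simp add: norm_N_eq form)
qed

text \<open>The arithmetic-geometric mean inequality for \<open>a powr q\<close> and
  \<open>b powr q\<close>. It turns a pointwise Cauchy-Schwarz product into a sum that can be
  integrated termwise.\<close>

lemma powr_mult_le_mean_square:
  fixes a b q :: real
  assumes "0 \<le> a" "0 \<le> b"
  shows "(a * b) powr q \<le> ((a\<^sup>2) powr q + (b\<^sup>2) powr q) / 2"
proof -
  have "(a\<^sup>2) powr q = (a powr q)\<^sup>2" "(b\<^sup>2) powr q = (b powr q)\<^sup>2" "(a * b) powr q = a powr q * b powr q"
    using assms by (simp_all add: power2_eq_square powr_mult)
  then show ?thesis
    using sum_squares_bound[of "a powr q" "b powr q"] by simp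
qed

lemma continuous_on_abs_form_powr:
  fixes X :: "complex ^ 'n ^ 'n"
  assumes "0 < q"
  shows "continuous_on UNIV (\<lambda>x. \<bar>x \<bullet> (X *v x)\<bar> powr q)"
  using assms by (intro continuous_on_powr' continuous_intros linear_continuous_on) auto

text \<open>
  With \<open>A = V |A|\<close> and \<open>S = sqrt_matrix |A|\<close>, the form \<open>x \<bullet> A x\<close> equals \<open>S V\<^sup>* x \<bullet> S x\<close>, and
  \<open>V\<^sup>*\<close> preserves the sphere measure.
\<close>

lemma integral_abs_form_powr_le:
  fixes A :: "complex ^ 'n ^ 'n"
  assumes q: "1 \<le> q"
  shows "(LINT x|sphere_measure. \<bar>x \<bullet> (A *v x)\<bar> powr q) \<le> norm_N q A powr q"
proof -
  define P where "P = abs_matrix A"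
  have P: "psd_matrix P" by (simp add: P_def psd_abs_matrix)
  define S where "S = sqrt_matrix P"
  have S: "adjoint_matrix S = S" "S ** S = P" "\<And>x. (norm (S *v x))\<^sup>2 = x \<bullet> (P *v x)"
    using psd_sqrt_matrix[OF P] by (simp_all add: S_def psd_matrix_adjoint norm_sqrt_matrix_mult_vec[OF P])
  obtain V where V: "unitary_matrix V" "A = V ** P"
    using matrix_eq_unitary_abs[of A] by (auto simp: P_def)
  define W where "W = adjoint_matrix V"
  have W: "orthogonal_transformation ((*v) W)"
    using V by (simp add: W_def orthogonal_transformation_unitary unitary_matrix_adjoint)
  let ?f = "\<lambda>x. (x \<bullet> (P *v x)) powr q"
  have cont: "continuous_on UNIV ?f"
    using q P by (intro continuous_on_quadratic_form_powr) auto
  have contW: "continuous_on UNIV (\<lambda>x. ?f (W *v x))"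
    by (rule continuous_on_compose2[OF cont]) (auto intro!: linear_continuous_on)
  have "\<bar>x \<bullet> (A *v x)\<bar> powr q \<le> (?f x + ?f (W *v x)) / 2" for x
  proof -
    have "x \<bullet> (A *v x) = (S *v (W *v x)) \<bullet> (S *v x)"
      by (simp add: W_def V(2) inner_matrix_left S(1) adjoint_matrix_mult matrix_vector_mul_assoc
          matrix_mul_assoc flip: S(2))
    then have "\<bar>x \<bullet> (A *v x)\<bar> \<le> norm (S *v x) * norm (S *v (W *v x))"
      by (metis Cauchy_Schwarz_ineq2 mult.commute)
    then have "\<bar>x \<bullet> (A *v x)\<bar> powr q \<le> (norm (S *v x) * norm (S *v (W *v x))) powr q"
      using q by (intro powr_mono2) auto
    also have "\<dots> \<le> (?f x + ?f (W *v x)) / 2"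
      using powr_mult_le_mean_square[of "norm (S *v x)" "norm (S *v (W *v x))" q] by (simp add: S)
    finally show ?thesis .
  qed
  moreover have "integrable sphere_measure (\<lambda>x. \<bar>x \<bullet> (A *v x)\<bar> powr q)"
    using q by (intro integrable_sphere_measure continuous_on_abs_form_powr) simp
  ultimately have "(LINT x|sphere_measure. \<bar>x \<bullet> (A *v x)\<bar> powr q) \<le>
      (LINT x|sphere_measure. (?f x + ?f (W *v x)) / 2)"
    using integrable_sphere_measure[OF cont] integrable_sphere_measure[OF contW]
    by (intro integral_mono) auto
  also have "\<dots> = ((LINT x|sphere_measure. ?f x) + (LINT x|sphere_measure. ?f (W *v x))) / 2"
    using integrable_sphere_measure[OF cont] integrable_sphere_measure[OF contW] by simp
  also have "(LINT x|sphere_measure. ?f (W *v x)) = (LINT x|sphere_measure. ?f x)"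
    using W borel_measurable_sphere_measure[OF cont] by (rule integral_sphere_measure_orthogonal)
  finally show ?thesis
    by (simp add: norm_N_powr[OF q] P_def)
qed

lemma norm_N_triangle:
  fixes A B :: "complex ^ 'n ^ 'n"
  assumes q: "1 \<le> q"
  shows "norm_N q (A + B) \<le> norm_N q A + norm_N q B"
\<comment> \<open>The zero cases are split off because \<open>integral_powr_add_le\<close> divides
  by its bounds, here \<open>norm_N q A\<close> and \<open>norm_N q B\<close>.\<close>
proof (cases "A = 0 \<or> B = 0")
  case True
  then show ?thesis by (auto simp: norm_N_nonneg)
next
  case False
  then have pos: "0 < norm_N q A" "0 < norm_N q B"
    using norm_N_eq_0_iff[OF q] norm_N_nonneg by (metis order_le_less)+
  obtain W where W: "unitary_matrix W" "abs_matrix (A + B) = W ** (A + B)"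
    using abs_matrix_polar by metis
  have WN: "norm_N q (W ** X) = norm_N q X" for X :: "complex ^ 'n ^ 'n"
  proof -
    have "unitary_matrix (mat 1 :: complex ^ 'n ^ 'n)"
      using W(1) unitary_matrix_adjoint unitary_matrix_mult by (metis unitary_matrix_def)
    from norm_N_unitary[OF q W(1) this, of X] show ?thesis by simp
  qed
  let ?u = "\<lambda>X x. \<bar>x \<bullet> ((W ** X) *v x)\<bar>"
  have cont: "continuous_on UNIV (\<lambda>x. (?u A x + ?u B x) powr q)"
    using q by (intro continuous_on_powr' continuous_intros linear_continuous_on) auto
  have "x \<bullet> (abs_matrix (A + B) *v x) \<le> ?u A x + ?u B x" for x
    by (simp add: W(2) matrix_add_ldistrib matrix_vector_mult_add_rdistrib inner_add_right)
  then have "(LINT x|sphere_measure. (x \<bullet> (abs_matrix (A + B) *v x)) powr q) \<le>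
      (LINT x|sphere_measure. (?u A x + ?u B x) powr q)"
    using q by (intro integral_mono integrable_sphere_measure cont continuous_on_quadratic_form_powr
        psd_abs_matrix powr_mono2 psd_matrix_nonneg) auto
  also have "\<dots> \<le> (norm_N q A + norm_N q B) powr q"
    using q pos integral_abs_form_powr_le[OF q, of "W ** A"] integral_abs_form_powr_le[OF q, of "W ** B"]
    by (intro integral_powr_add_le integrable_sphere_measure continuous_on_abs_form_powr) (auto simp: WN)
  finally have "norm_N q (A + B) powr q \<le> (norm_N q A + norm_N q B) powr q"
    by (simp add: norm_N_powr[OF q])
  then show ?thesis
    using q pos powr_less_mono2[of q "norm_N q A + norm_N q B" "norm_N q (A + B)"]
    by (meson add_nonneg_nonneg less_le_not_le linorder_not_less norm_N_nonneg
        order_less_le_trans zero_less_one)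
qed

theorem theorem2p1:
  fixes q :: real
  assumes "q \<ge> 1"
  shows "unitarily_invariant_norm (norm_N q :: complex ^ 'n ^ 'n \<Rightarrow> real)"
  using assms
  by (auto simp: unitarily_invariant_norm_def norm_on_matrices_def norm_N_nonneg norm_N_eq_0_iff
      norm_N_scale norm_N_triangle norm_N_unitary)

end
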